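(* Let $m=(m^{(n)})_{n\in\mathbb{N}_0}\in\mathcal{F}(\mathcal{R}(\mathbb{R}^d))$. Suppose that for each $n\in\mathbb{N}$ there are functions $k_2^{(n)},\tilde k_2^{(n)}\in\mathcal{C}^\infty(\mathbb{R}^d)$ with $k_2^{(n)}(\mathbf{r})\ge1$ and $\tilde k_2^{(n)}(\mathbf{r})\ge|(D^\kappa k_2^{(n)})(\mathbf{r})|^2$ for all $\mathbf{r}\in\mathbb{R}^d$ and all multi-indices $|\kappa|\le\lceil\frac{d+1}{2}\rceil$, such that $$\sum_{n=1}^\infty\frac{1}{\Big(\sup_{\mathbf{z}\in\mathbb{R}^d,\,\|\mathbf{z}\|\le n}\ \sup_{\mathbf{x}\in[-1,1]^d}\sqrt{\tilde k_2^{(2n)}(\mathbf{z}+\mathbf{x})}\Big)\sqrt[2n]{\int_{\mathbb{R}^{2nd}}\frac{m^{(2n)}(d\mathbf{r}_1,\dots,d\mathbf{r}_{2n})}{\prod_{l=1}^{2n}k_2^{(2n)}(\mathbf{r}_l)}}}=\infty$$ and $$\int_{\mathbb{R}^{2nd}}\frac{m^{(2n)}(d\mathbf{r}_1,\dots,d\mathbf{r}_{2n})}{\prod_{l=1}^{2n}k_2^{(2n)}(\mathbf{r}_l)}<\infty\qquad\text{for all } n\in\mathbb{N}_0.$$ Then $m$ is a determining sequence.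
   Context: $\mathcal{R}(\mathbb{R}^d)$ is the set of all non-negative Borel measures on $\mathbb{R}^d$ that are finite on compact sets. $\mathcal{F}(\mathcal{R}(\mathbb{R}^d))$ is the set of sequences $(m^{(n)})_{n\in\mathbb{N}_0}$ with each $m^{(n)}\in\mathcal{R}(\mathbb{R}^{dn})$ symmetric in its $n$ variables in $\mathbb{R}^d$ ($m^{(0)}$ a non-negative number, to which the integral reduces for $n=0$). For a test function $f$ on $\mathbb{R}^{dn}$, $\langle f,m^{(n)}\rangle=\int f\,dm^{(n)}$. Conventions: $1/0=\infty$. $\mathcal{C}_c^\infty(\mathbb{R}^d)$ is the space of real-valued infinitely differentiable functions on $\mathbb{R}^d$ with compact support. Let $I$ be the set of all pairs $k=(k_1,k_2)$ with $k_1\in\mathbb{N}_0$, $k_2\in\mathcal{C}^\infty(\mathbb{R}^d)$ and $k_2\ge1$. For $k\in I$ let $H_k=W_2^{k_1}(\mathbb{R}^d,k_2(\mathbf{r})d\mathbf{r})$ be the completion of $\mathcal{C}_c^\infty(\mathbb{R}^d)$ with respect to the norm $\big(\sum_{|\beta|\le k_1}\int_{\mathbb{R}^d}|D^\beta\varphi(\mathbf{r})|^2k_2(\mathbf{r})\,d\mathbf{r}\big)^{1/2}$. $\mathscr{D}(\mathbb{R}^d)$ denotes $\mathcal{C}_c^\infty(\mathbb{R}^d)$ with the projective limit topology of the family $(H_k)_{k\in I}$. A subset $E$ of $\mathscr{D}(\mathbb{R}^d)$ is total if its linear span is dense in $\mathscr{D}(\mathbb{R}^d)$. For a sequence $(M_n)_{n\in\mathbb{N}_0}$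 of non-negative reals, $C\{M_n\}$ is the set of $f\in\mathcal{C}^\infty(\mathbb{R})$ for which there are constants $\beta_f,B_f>0$ with $\sup_{x\in\mathbb{R}}|D^nf(x)|\le\beta_fB_f^nM_n$ for all $n\in\mathbb{N}_0$. The class is quasi-analytic if every $f\in C\{M_n\}$ with $D^nf(0)=0$ for all $n\in\mathbb{N}_0$ vanishes identically. The sequence $m$ is determining if there exists a total subset $E$ of $\mathscr{D}(\mathbb{R}^d)$ such that, with $m_0:=\sqrt{|m^{(0)}|}$ and $m_n:=\sqrt{\sup_{f_1,\dots,f_{2n}\in E}|\langle f_1\otimes\cdots\otimes f_{2n},m^{(2n)}\rangle|}$ for $n\ge1$, one has $m_n<\infty$ for all $n$ and the class $C\{m_n\}$ is quasi-analytic. *)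

theory Defs
  imports "HOL-Analysis.Analysis"
begin

section \<open>Smooth functions and multi-index derivatives\<close>

definition partial_deriv :: "'d::finite \<Rightarrow> (real ^ 'd \<Rightarrow> real) \<Rightarrow> real ^ 'd \<Rightarrow> real" where
  "partial_deriv i f = (\<lambda>x. frechet_derivative f (at x) (axis i 1))"

primrec C_k :: "nat \<Rightarrow> (real ^ 'd::finite \<Rightarrow> real) \<Rightarrow> bool" where
  "C_k 0 f \<longleftrightarrow> continuous_on UNIV f"
| "C_k (Suc n) f \<longleftrightarrow> (\<forall>x. f differentiable (at x)) \<and> (\<forall>i. C_k n (partial_deriv i f))"

definition C_infinity :: "(real ^ 'd::finite \<Rightarrow> real) set" where
  "C_infinity = {f. \<forall>n. C_k n f}"

definition C_infinity_c :: "(real ^ 'd::finite \<Rightarrow> real) set" where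
  "C_infinity_c = {f \<in> C_infinity. compact (closure {x. f x \<noteq> 0})}"

definition mi_order :: "('d::finite \<Rightarrow> nat) \<Rightarrow> nat" where
  "mi_order \<beta> = (\<Sum>i\<in>UNIV. \<beta> i)"

text \<open>
  The index type carries no order, so the derivatives are taken in the order of some
  list in which each index \<open>i\<close> occurs \<open>\<beta> i\<close> times; such a list exists
  by \<open>ex_mi_list\<close> below. The operator is only applied to smooth functions, for
  which, by the symmetry of mixed partial derivatives, the choice does not matter.
\<close>

definition mi_list :: "('d::finite \<Rightarrow> nat) \<Rightarrow> 'd list" where
  "mi_list \<beta> = (SOME xs. \<forall>i. count_list xs i = \<beta> i)"

definition mi_deriv ::
    "('d::finite \<Rightarrow> nat) \<Rightarrow> (real ^ 'd \<Rightarrow> real) \<Rightarrow> real ^ 'd \<Rightarrow> real" where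
  "mi_deriv \<beta> f = foldr partial_deriv (mi_list \<beta>) f"

lemma ex_mi_list: "\<exists>xs. \<forall>i. count_list xs i = (\<beta> :: 'd::finite \<Rightarrow> nat) i"
proof -
  obtain xs where "mset xs = Abs_multiset \<beta>"
    using ex_mset by blast
  then have "count (mset xs) i = \<beta> i" for i
    by simp
  then show ?thesis
    by (metis count_mset)
qed

section \<open>The test function space\<close>

text \<open>The index set of the family of weighted Sobolev spaces.\<close>

definition sobolev_index :: "(nat \<times> (real ^ 'd::finite \<Rightarrow> real)) set" where
  "sobolev_index = {(k1, k2). k2 \<in> C_infinity \<and> (\<forall>r. k2 r \<ge> 1)}"

definition sobolev_norm ::
    "nat \<times> (real ^ 'd::finite \<Rightarrow> real) \<Rightarrow> (real ^ 'd \<Rightarrow> real) \<Rightarrow> real" where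
  "sobolev_norm k \<phi> =
     sqrt (\<Sum>\<beta> | mi_order \<beta> \<le> fst k. \<integral>r. \<bar>mi_deriv \<beta> \<phi> r\<bar>\<^sup>2 * snd k r \<partial>lborel)"

text \<open>
  The projective limit topology of the spaces \<open>H\<^sub>k\<close> is the coarsest topology on the
  compactly supported smooth functions for which all inclusions into the completions
  \<open>H\<^sub>k\<close> are continuous. The inclusions are isometric with dense range, so the
  preimages of the open subsets of \<open>H\<^sub>k\<close> are exactly the unions of the norm balls
  below. (The ball family is non-empty and its union is \<open>C_infinity_c\<close>, which is
  therefore the topspace.)
\<close>

definition sobolev_ball ::
    "nat \<times> (real ^ 'd::finite \<Rightarrow> real) \<Rightarrow> (real ^ 'd \<Rightarrow> real) \<Rightarrow> real \<Rightarrow> (real ^ 'd \<Rightarrow> real) set" where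
  "sobolev_ball k \<phi> \<epsilon> = {\<psi> \<in> C_infinity_c. sobolev_norm k (\<lambda>r. \<psi> r - \<phi> r) < \<epsilon>}"

definition D_topology :: "(real ^ 'd::finite \<Rightarrow> real) topology" where
  "D_topology = topology_generated_by
     {sobolev_ball k \<phi> \<epsilon> | k \<phi> \<epsilon>. k \<in> sobolev_index \<and> \<phi> \<in> C_infinity_c \<and> \<epsilon> > 0}"

definition linear_span :: "('a \<Rightarrow> real) set \<Rightarrow> ('a \<Rightarrow> real) set" where
  "linear_span E = {(\<lambda>x. \<Sum>f\<in>F. c f * f x) | F c. finite F \<and> F \<subseteq> E}"

definition total_in_D :: "(real ^ 'd::finite \<Rightarrow> real) set \<Rightarrow> bool" where
  "total_in_D E \<longleftrightarrow>
     E \<subseteq> C_infinity_c \<and> D_topology closure_of (linear_span E) = C_infinity_c"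

section \<open>Sequences of symmetric Radon measures\<close>

text \<open>
  The space \<open>\<real>\<close>-to-the-\<open>dn\<close> is the \<open>n\<close>-fold product of \<open>real ^ 'd\<close>, realised by
  functions on \<open>{..<n}\<close> (extensional outside this set); the product sigma-algebra is
  the Borel sigma-algebra of the product topology. For \<open>n = 0\<close> the space has a single
  point, and the measure is identified with its total mass.
\<close>

abbreviation product_borel :: "nat \<Rightarrow> (nat \<Rightarrow> real ^ 'd::finite) measure" where
  "product_borel n \<equiv> \<Pi>\<^sub>M i\<in>{..<n}. borel"

definition radon_measure :: "nat \<Rightarrow> (nat \<Rightarrow> real ^ 'd::finite) measure \<Rightarrow> bool" where
  "radon_measure n \<mu> \<longleftrightarrow>
     sets \<mu> = sets (product_borel n) \<and>
     (\<forall>K. compactin (product_topology (\<lambda>i. euclidean) {..<n}) K \<longrightarrow> emeasure \<mu> K < \<infinity>)"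

definition symmetric_measure :: "nat \<Rightarrow> (nat \<Rightarrow> real ^ 'd::finite) measure \<Rightarrow> bool" where
  "symmetric_measure n \<mu> \<longleftrightarrow>
     (\<forall>\<pi>. \<pi> permutes {..<n} \<longrightarrow>
        distr \<mu> (product_borel n) (\<lambda>x. \<lambda>i\<in>{..<n}. x (\<pi> i)) = \<mu>)"

definition radon_sequence :: "(nat \<Rightarrow> (nat \<Rightarrow> real ^ 'd::finite) measure) \<Rightarrow> bool" where
  "radon_sequence m \<longleftrightarrow> (\<forall>n. radon_measure n (m n) \<and> symmetric_measure n (m n))"

section \<open>Quasi-analytic classes and determining sequences\<close>

definition carleman_class :: "(nat \<Rightarrow> real) \<Rightarrow> (real \<Rightarrow> real) set" where
  "carleman_class M =
     {f. (\<forall>n x. ((deriv ^^ n) f) field_differentiable (at x)) \<and>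
         (\<exists>\<beta>>0. \<exists>B>0. \<forall>n x. \<bar>(deriv ^^ n) f x\<bar> \<le> \<beta> * B ^ n * M n)}"

definition quasi_analytic :: "(nat \<Rightarrow> real) \<Rightarrow> bool" where
  "quasi_analytic M \<longleftrightarrow>
     (\<forall>f\<in>carleman_class M. (\<forall>n. (deriv ^^ n) f 0 = 0) \<longrightarrow> (\<forall>x. f x = 0))"

definition ennroot :: "nat \<Rightarrow> ennreal \<Rightarrow> ennreal" where
  "ennroot n x = (if x = \<infinity> then \<infinity> else ennreal (root n (enn2real x)))"

text \<open>The extended non-negative numbers \<open>m\<^sub>n\<close> associated with a set \<open>E\<close> of test functions.\<close>

definition det_coeff ::
    "(nat \<Rightarrow> (nat \<Rightarrow> real ^ 'd::finite) measure) \<Rightarrow> (real ^ 'd \<Rightarrow> real) set \<Rightarrow> nat \<Rightarrow> ennreal" where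
  "det_coeff m E n =
     (if n = 0 then ennreal (sqrt \<bar>measure (m 0) (space (m 0))\<bar>)
      else ennroot 2 (SUP f \<in> {..<2 * n} \<rightarrow> E.
             ennreal \<bar>\<integral>x. (\<Prod>i<2 * n. f i (x i)) \<partial>m (2 * n)\<bar>))"

definition determining :: "(nat \<Rightarrow> (nat \<Rightarrow> real ^ 'd::finite) measure) \<Rightarrow> bool" where
  "determining m \<longleftrightarrow>
     (\<exists>E. total_in_D E \<and> (\<forall>n. det_coeff m E n < \<infinity>) \<and>
          quasi_analytic (\<lambda>n. enn2real (det_coeff m E n)))"

section \<open>Weighted moments\<close>

definition weighted_moment ::
    "(nat \<Rightarrow> (nat \<Rightarrow> real ^ 'd::finite) measure) \<Rightarrow> (nat \<Rightarrow> real ^ 'd \<Rightarrow> real) \<Rightarrow> nat \<Rightarrow> ennreal" where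
  "weighted_moment m k n =
     (\<integral>\<^sup>+ x. ennreal (1 / (\<Prod>l<2 * n. k (2 * n) (x l))) \<partial>m (2 * n))"

end

theory Submission
  imports Defs
begin

text \<open>
  Every test function can be scaled so that, for all \<open>n \<ge> 1\<close>, its product with
  \<open>k (2 * n)\<close> is bounded by the maximum of \<open>k (2 * n)\<close> over the ball of radius \<open>n\<close>: the
  bound is automatic once the ball contains the support. The set \<open>E\<close> of all test functions with
  this property is therefore total, and its coefficients satisfy the divergence condition of
  the Denjoy--Carleman theorem.

  That theorem is needed for sequences \<open>M\<close> that are not assumed logarithmically convex. It is
  proved by Bang's method: Taylor's formula shows that the size of all derivatives,
  relative to the log-convex minorant of \<open>M\<close>, cannot grow too fast away from a zero of infinite
  order. Taking Taylor expansions only up to the vertices of the Newton polygon of \<open>ln M\<close>, where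
  \<open>M\<close> and its minorant agree, makes the Gorny--Kolmogorov inequalities unnecessary.
  Carleman's inequality transfers the divergence of the given series to the minorant.
\<close>

section \<open>Carleman's inequality\<close>

text \<open>The inequality of arithmetic and geometric means in exponential form: the graph of exp
  lies above its tangent at the mean, and the linear terms cancel on summation.\<close>

lemma exp_mean_le:
  fixes y :: "nat \<Rightarrow> real"
  assumes "n > 0"
  shows "exp ((\<Sum>j<n. y j) / n) \<le> (\<Sum>j<n. exp (y j)) / n"
proof -
  define \<mu> where "\<mu> = (\<Sum>j<n. y j) / n"
  have "n * exp \<mu> = (\<Sum>j<n. exp \<mu> * (1 + (y j - \<mu>)))"
    using assms by (simp add: \<mu>_def sum.distrib sum_subtractf flip: sum_distrib_left)
  also have "\<dots> \<le> (\<Sum>j<n. exp (y j))"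
  proof (rule sum_mono)
    fix j
    have "exp \<mu> * (1 + (y j - \<mu>)) \<le> exp \<mu> * exp (y j - \<mu>)"
      by (intro mult_left_mono exp_ge_add_one_self) auto
    then show "exp \<mu> * (1 + (y j - \<mu>)) \<le> exp (y j)"
      by (simp flip: exp_add)
  qed
  finally show ?thesis
    using assms by (simp add: \<mu>_def field_simps)
qed

text \<open>Polya's argument for the terms \<open>exp (- s j)\<close>: the means inequality is
  applied to the terms weighted by \<open>c j\<close>, the two sums are interchanged, and the total
  weight of each term is at most \<open>c j / (j + 1) = (1 + 1 / (j + 1)) ^ (j + 1)\<close>, hence
  at most e.\<close>

lemma carleman_inequality:
  fixes s :: "nat \<Rightarrow> real"
  shows "(\<Sum>n<N. exp (- (\<Sum>j\<le>n. s j) / Suc n)) \<le> exp 1 * (\<Sum>j<N. exp (- s j))"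
proof -
  \<comment> \<open>The product of the weights up to n telescopes to
    \<open>(n + 2) ^ (n + 1)\<close>, so their geometric mean is n + 2. Together with the factor 1 /
    (n + 1) of the arithmetic mean this gives the telescoping weight 1 / ((n + 1) (n + 2)).\<close>
  define c :: "nat \<Rightarrow> real" where "c j = (real j + 2) ^ Suc j / (real j + 1) ^ j" for j
  have c_pos: "c j > 0" for j
    by (auto simp: c_def intro!: divide_pos_pos)
  have sum_ln_c: "(\<Sum>j\<le>n. ln (c j)) = Suc n * ln (real n + 2)" for n
  proof (induction n)
    case (Suc n)
    have "ln (c (Suc n)) = (real n + 2) * ln (real n + 3) - (real n + 1) * ln (real n + 2)"
      by (simp add: c_def ln_div ln_mult ln_realpow algebra_simps del: power_Suc)
    then show ?case
      using Suc by (simp add: algebra_simps)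
  qed (simp add: c_def)
  have mean: "exp (- (\<Sum>j\<le>n. s j) / Suc n)
      \<le> (\<Sum>j\<le>n. c j * exp (- s j)) * (1 / (real n + 1) - 1 / (real n + 2))" for n
  proof -
    have "exp ((\<Sum>j<Suc n. ln (c j) - s j) / Suc n) \<le> (\<Sum>j<Suc n. exp (ln (c j) - s j)) / Suc n"
      by (rule exp_mean_le) simp
    moreover have "(\<Sum>j<Suc n. ln (c j) - s j) / Suc n = ln (real n + 2) + (- (\<Sum>j\<le>n. s j) / Suc n)"
      by (simp only: lessThan_Suc_atMost sum_subtractf sum_ln_c) (simp add: field_simps)
    moreover have "exp (ln (c j) - s j) = c j * exp (- s j)" for j
      using c_pos[of j] by (simp add: exp_diff exp_minus field_simps)
    ultimately have "(real n + 2) * exp (- (\<Sum>j\<le>n. s j) / Suc n) \<le> (\<Sum>j\<le>n. c j * exp (- s j)) / Suc n"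
      by (simp only: lessThan_Suc_atMost exp_add) simp
    then have "exp (- (\<Sum>j\<le>n. s j) / Suc n) \<le> (\<Sum>j\<le>n. c j * exp (- s j)) / Suc n / (real n + 2)"
      by (simp add: pos_le_divide_eq mult.commute)
    also have "\<dots> = (\<Sum>j\<le>n. c j * exp (- s j)) * (1 / (real n + 1) - 1 / (real n + 2))"
      by (simp add: divide_simps)
    finally show ?thesis .
  qed
  \<comment> \<open>Interchange of the sums by induction on \<open>N\<close>: for fixed j the
    weights with n from j to N - 1 add up to 1 / (j + 1) - 1 / (N + 1).\<close>
  have "(\<Sum>n<N. exp (- (\<Sum>j\<le>n. s j) / Suc n))
      \<le> (\<Sum>j<N. c j * exp (- s j) * (1 / (real j + 1) - 1 / (real N + 1)))"
  proof (induction N)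
    case (Suc N)
    have "(\<Sum>n<Suc N. exp (- (\<Sum>j\<le>n. s j) / Suc n))
        \<le> (\<Sum>j<N. c j * exp (- s j) * (1 / (real j + 1) - 1 / (real N + 1)))
          + (\<Sum>j\<le>N. c j * exp (- s j)) * (1 / (real N + 1) - 1 / (real N + 2))"
      using Suc mean[of N] by simp
    also have "\<dots> = (\<Sum>j<Suc N. c j * exp (- s j) * (1 / (real j + 1) - 1 / (real (Suc N) + 1)))"
    proof -
      have "(\<Sum>j<N. x j * (y j - u)) + (\<Sum>j\<le>N. x j) * (u - v) = (\<Sum>j<Suc N. x j * (y j - v))"
        if "y N = u" for x y :: "nat \<Rightarrow> real" and u v
      proof -
        \<comment> \<open>The added term j = N is zero because \<open>y N = u\<close>; afterwards
          both sums have the same range.\<close>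
        have "(\<Sum>j<N. x j * (y j - u)) = (\<Sum>j<Suc N. x j * (y j - u))"
          using that by simp
        then show ?thesis
          by (simp only: sum_distrib_right lessThan_Suc_atMost flip: sum.distrib) (simp add: algebra_simps)
      qed
      from this[of "\<lambda>j. 1 / (real j + 1)" "1 / (real N + 1)" "\<lambda>j. c j * exp (- s j)" "1 / (real (Suc N) + 1)", OF refl]
      moreover have "real N + 2 = real (Suc N) + 1"
        by simp
      ultimately show ?thesis
        by (simp only:)
    qed
    finally show ?case .
  qed simp
  also have "\<dots> \<le> (\<Sum>j<N. exp 1 * exp (- s j))"
  proof (rule sum_mono)
    fix j
    have "(1 + 1 / of_nat (Suc j)) ^ Suc j \<le> exp (1::real)"
      by (rule exp_ge_one_plus_x_over_n_power_n) auto
    moreover have "c j * (1 / (real j + 1)) = (1 + 1 / of_nat (Suc j)) ^ Suc j"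
    proof -
      have "1 + 1 / of_nat (Suc j) = (real j + 2) / (real j + 1)"
        by (simp add: field_simps)
      then show ?thesis
        by (simp add: c_def power_divide mult.commute)
    qed
    ultimately have c_le: "c j * (1 / (real j + 1)) \<le> exp 1"
      by simp
    have "c j * exp (- s j) * (1 / (real j + 1) - 1 / (real N + 1)) \<le> c j * exp (- s j) * (1 / (real j + 1))"
      using c_pos[of j] by (intro mult_left_mono) auto
    also have "\<dots> = c j * (1 / (real j + 1)) * exp (- s j)"
      by simp
    also have "\<dots> \<le> exp 1 * exp (- s j)"
      using c_le by (intro mult_right_mono) auto
    finally show "c j * exp (- s j) * (1 / (real j + 1) - 1 / (real N + 1)) \<le> exp 1 * exp (- s j)" .
  qed
  finally show ?thesis
    by (simp flip: sum_distrib_left)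
qed

section \<open>The Newton polygon of a superlinear sequence\<close>

text \<open>Superlinear growth makes the chord slopes from any fixed point attain a minimum, so
  every edge of the polygon has finite length. The intended \<open>A n\<close> is
  \<open>ln (M n)\<close>.\<close>

locale superlinear =
  fixes A :: "nat \<Rightarrow> real"
  assumes superlinear: "\<And>K. eventually (\<lambda>n. A n > K * real n) sequentially"
begin

definition slope :: "nat \<Rightarrow> nat \<Rightarrow> real" where
  "slope p q = (A q - A p) / (real q - real p)"

lemma ex_next_vertex: "\<exists>q>p. \<forall>r>p. slope p q \<le> slope p r"
proof -
  define S where "S = slope p (Suc p)"
  \<comment> \<open>For r > p this gives \<open>K * r - A p\<close> at least
    \<open>\<bar>S\<bar> * r\<close>, hence at least \<open>S * (r - p)\<close>; so from
    \<open>N\<close> on no chord is flatter than the first one.\<close>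
  define K where "K = \<bar>S\<bar> + \<bar>A p\<bar>"
  obtain N where N: "\<And>n. n \<ge> N \<Longrightarrow> A n > K * real n"
    using superlinear[of K] by (auto simp: eventually_sequentially)
  have large: "S \<le> slope p r" if "r > p" "r \<ge> N" for r
  proof -
    have "S * (real r - real p) \<le> \<bar>S\<bar> * (real r - real p)"
      using that by (intro mult_right_mono) auto
    also have "\<dots> \<le> \<bar>S\<bar> * real r"
      by (intro mult_left_mono) auto
    also have "\<dots> \<le> K * r - A p"
    proof -
      have "\<bar>A p\<bar> * 1 \<le> \<bar>A p\<bar> * real r"
        using that by (intro mult_left_mono) auto
      then show ?thesis
        by (simp add: K_def algebra_simps)
    qed
    also have "\<dots> \<le> A r - A p"
      using N[OF that(2)] by simp
    finally show ?thesis
      using that by (simp add: slope_def field_simps)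
  qed
  \<comment> \<open>Every r > p outside this finite window is at least \<open>N\<close>, and p + 1
    lies inside it, so a minimum over the window is a minimum over all r > p.\<close>
  define T where "T = {p<..p + N + 1}"
  have "finite T" "T \<noteq> {}"
    by (auto simp: T_def)
  then obtain q where q: "q \<in> T" "\<And>r. r \<in> T \<Longrightarrow> slope p q \<le> slope p r"
    using ex_min_if_finite[of "slope p ` T"] by (auto simp: not_less)
  have "slope p q \<le> slope p r" if "r > p" for r
  proof (cases "r \<in> T")
    case False
    have "slope p q \<le> S"
      using q(2)[of "Suc p"] by (simp add: T_def S_def)
    also have "\<dots> \<le> slope p r"
      using False that by (intro large) (auto simp: T_def)
    finally show ?thesis .
  qed (use q in auto)
  then show ?thesis
    using q(1) by (auto simp: T_def)
qed

text \<open>Any minimiser will do: in case of ties, consecutive edges may have equal slope, which is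
  compatible with convexity.\<close>

definition next_vertex :: "nat \<Rightarrow> nat" where
  "next_vertex p = (SOME q. q > p \<and> (\<forall>r>p. slope p q \<le> slope p r))"

lemma next_vertex_gt: "next_vertex p > p" and slope_next_vertex_le: "r > p \<Longrightarrow> slope p (next_vertex p) \<le> slope p r"
  using someI_ex[OF ex_next_vertex[of p]] by (auto simp: next_vertex_def)

text \<open>
  The vertices of the polygon are the numbers \<open>p\<close> with \<open>last_vertex p = p\<close>; the greatest convex
  minorant has slope \<open>seg_slope n\<close> between \<open>n\<close> and \<open>n + 1\<close>.
\<close>

primrec last_vertex :: "nat \<Rightarrow> nat" where
  "last_vertex 0 = 0"
| "last_vertex (Suc n) = (if Suc n = next_vertex (last_vertex n) then Suc n else last_vertex n)"

definition seg_slope :: "nat \<Rightarrow> real" where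
  "seg_slope n = slope (last_vertex n) (next_vertex (last_vertex n))"

definition minorant :: "nat \<Rightarrow> real" where
  "minorant n = A 0 + (\<Sum>i<n. seg_slope i)"

lemma last_vertex_bounds: "last_vertex n \<le> n \<and> n < next_vertex (last_vertex n)"
  by (induction n) (use next_vertex_gt in \<open>auto simp: le_Suc_eq\<close>)

lemma last_vertex_Suc: "Suc n = next_vertex (last_vertex n) \<Longrightarrow> last_vertex (Suc n) = Suc n"
  unfolding last_vertex.simps by (rule if_P)

text \<open>The accumulated slopes interpolate linearly along an edge. On reaching its end they give
  exactly the value of \<open>A\<close> there, from which the next edge starts.\<close>

lemma minorant_eq: "minorant n = A (last_vertex n) + (real n - real (last_vertex n)) * seg_slope n"
proof (induction n)
  case (Suc n)
  have minorant_Suc: "minorant (Suc n) = A (last_vertex n) + (real (Suc n) - real (last_vertex n)) * seg_slope n"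
    using Suc by (simp add: minorant_def algebra_simps)
  show ?case
  proof (cases "Suc n = next_vertex (last_vertex n)")
    case True
    have "real (Suc n) - real (last_vertex n) \<noteq> 0"
      using last_vertex_bounds[of n] by simp
    then have "minorant (Suc n) = A (Suc n)"
      unfolding minorant_Suc seg_slope_def slope_def True[symmetric] by (simp del: of_nat_Suc)
    then show ?thesis
      using last_vertex_Suc[OF True] by (simp del: last_vertex.simps)
  next
    case False
    then show ?thesis
      unfolding minorant_Suc by (simp add: seg_slope_def)
  qed
qed (simp add: minorant_def)

text \<open>The edge starting at the last vertex has the least slope among all chords from there, so
  \<open>A\<close> cannot dip below it.\<close>

lemma minorant_le: "minorant n \<le> A n"
proof (cases "last_vertex n = n")
  case False
  then have "n > last_vertex n"
    using last_vertex_bounds[of n] by simp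
  then have "seg_slope n \<le> slope (last_vertex n) n"
    unfolding seg_slope_def by (rule slope_next_vertex_le)
  then show ?thesis
    using \<open>n > last_vertex n\<close> by (simp add: minorant_eq slope_def field_simps)
qed (simp add: minorant_eq)

lemma minorant_vertex: "last_vertex p = p \<Longrightarrow> minorant p = A p"
  by (simp add: minorant_eq)

text \<open>The slope changes only at a vertex q between p and r. If the chord from p to q is no
  steeper than the one from p to r, it is also no steeper than the one from q to r.\<close>

lemma seg_slope_Suc_ge: "seg_slope n \<le> seg_slope (Suc n)"
proof (cases "Suc n = next_vertex (last_vertex n)")
  case True
  define p q r where "p = last_vertex n" and "q = Suc n" and "r = next_vertex q"
  have pqr: "p < q" "q < r" "last_vertex q = q"
    using last_vertex_bounds[of n] next_vertex_gt[of q] last_vertex_Suc[OF True]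
    by (auto simp: p_def q_def r_def simp del: last_vertex.simps)
  have "slope p q \<le> slope p r"
    using slope_next_vertex_le[of p r] pqr True by (simp add: p_def q_def)
  have "slope p q \<le> slope q r"
  proof -
    define t where "t = slope p q"
    have "A q - A p = t * (real q - real p)"
      using pqr by (simp add: t_def slope_def)
    moreover have "t * (real r - real p) \<le> A r - A p"
      using \<open>slope p q \<le> slope p r\<close> pqr by (simp add: t_def[symmetric]) (simp add: slope_def field_simps)
    ultimately have "t * (real r - real q) \<le> A r - A q"
      by (simp add: algebra_simps)
    then show ?thesis
      using pqr by (simp add: t_def[symmetric]) (simp add: slope_def field_simps)
  qed
  then show ?thesis
    using True pqr(3) by (simp add: seg_slope_def p_def q_def r_def del: last_vertex.simps)
next
  case False
  then show ?thesis
    by (simp add: seg_slope_def)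
qed

lemma seg_slope_mono: "i \<le> j \<Longrightarrow> seg_slope i \<le> seg_slope j"
  by (rule lift_Suc_mono_le[of seg_slope, OF seg_slope_Suc_ge])

lemma last_vertex_eq:
  assumes "last_vertex p = p" "p \<le> n" "n < next_vertex p"
  shows "last_vertex n = p"
  using assms(2,3)
proof (induction n rule: dec_induct)
  case (step n)
  then show ?case
    by simp
qed (rule assms)

lemma last_vertex_next_vertex:
  assumes "last_vertex p = p"
  shows "last_vertex (next_vertex p) = next_vertex p"
proof -
  define n where "n = next_vertex p - 1"
  have n: "Suc n = next_vertex p" "p \<le> n"
    using next_vertex_gt[of p] by (auto simp: n_def)
  then have "last_vertex n = p"
    by (intro last_vertex_eq[OF assms]) auto
  then have "Suc n = next_vertex (last_vertex n)"
    using n by simp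
  from last_vertex_Suc[OF this] show ?thesis
    using n(1) by metis
qed

text \<open>By convexity no edge up to the end of the edge at \<open>p\<close> is steeper than that
  edge. This compares all derivatives in a Taylor expansion ending at \<open>next_vertex p\<close>
  with a geometric progression.\<close>

lemma minorant_diff_le:
  assumes "last_vertex p = p" "n + j \<le> next_vertex p"
  shows "minorant (n + j) - minorant n \<le> j * seg_slope p"
  using assms(2)
proof (induction j)
  case (Suc j)
  have "seg_slope (n + j) \<le> seg_slope p"
  proof (cases "n + j \<le> p")
    case False
    then have "last_vertex (n + j) = p"
      using Suc.prems by (intro last_vertex_eq[OF assms(1)]) auto
    then show ?thesis
      by (simp add: seg_slope_def assms(1))
  qed (rule seg_slope_mono)
  moreover have "minorant (n + Suc j) = minorant (n + j) + seg_slope (n + j)"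
    by (simp add: minorant_def)
  ultimately show ?case
    using Suc by (simp add: algebra_simps)
qed simp

lemma sum_exp_seg_slope_vertex:
  assumes "last_vertex p = p"
  shows "(\<Sum>i=p..<next_vertex p. exp (- seg_slope i)) = (real (next_vertex p) - real p) * exp (- seg_slope p)"
proof -
  have "(\<Sum>i=p..<next_vertex p. exp (- seg_slope i)) = (\<Sum>i=p..<next_vertex p. exp (- seg_slope p))"
    using last_vertex_eq[OF assms] assms by (intro sum.cong) (auto simp: seg_slope_def)
  then show ?thesis
    using next_vertex_gt[of p] by (simp add: of_nat_diff)
qed

text \<open>Carleman's inequality is applied to the slopes, whose mean up to n is
  \<open>(minorant (n + 1) - A 0) / (n + 1)\<close>. Since the minorant lies below \<open>A\<close>,
  summability would pass to the original series, the term \<open>A 0\<close> costing at most a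
  factor \<open>exp \<bar>A 0\<bar>\<close>.\<close>

lemma not_summable_exp_slopes:
  assumes "\<not> summable (\<lambda>n. exp (- A (Suc n) / Suc n))"
  shows "\<not> summable (\<lambda>i. exp (- seg_slope i))"
proof
  assume summable: "summable (\<lambda>i. exp (- seg_slope i))"
  have "summable (\<lambda>n. exp (- (\<Sum>j\<le>n. seg_slope j) / Suc n))"
  proof (rule bounded_imp_summable)
    fix N
    have "(\<Sum>n<Suc N. exp (- (\<Sum>j\<le>n. seg_slope j) / Suc n)) \<le> exp 1 * (\<Sum>j<Suc N. exp (- seg_slope j))"
      by (rule carleman_inequality)
    also have "\<dots> \<le> exp 1 * (\<Sum>j. exp (- seg_slope j))"
      by (intro mult_left_mono sum_le_suminf summable) auto
    finally show "(\<Sum>n\<le>N. exp (- (\<Sum>j\<le>n. seg_slope j) / Suc n)) \<le> exp 1 * (\<Sum>j. exp (- seg_slope j))"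
      by (simp add: lessThan_Suc_atMost)
  qed auto
  then have "summable (\<lambda>n. exp \<bar>A 0\<bar> * exp (- (\<Sum>j\<le>n. seg_slope j) / Suc n))"
    by (rule summable_mult)
  then have "summable (\<lambda>n. exp (- A (Suc n) / Suc n))"
  proof (rule summable_comparison_test'[where N = 0])
    fix n
    have "- \<bar>A 0\<bar> * Suc n + (\<Sum>j\<le>n. seg_slope j) \<le> A 0 + (\<Sum>j\<le>n. seg_slope j)"
      by (simp add: algebra_simps) (smt (verit) mult_nonneg_nonneg of_nat_0_le_iff)
    also have "\<dots> \<le> A (Suc n)"
      using minorant_le[of "Suc n"] by (simp add: minorant_def lessThan_Suc_atMost)
    finally have "- A (Suc n) \<le> (\<bar>A 0\<bar> + (- (\<Sum>j\<le>n. seg_slope j) / Suc n)) * Suc n"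
      by (simp add: left_diff_distrib del: of_nat_Suc)
    then have "- A (Suc n) / Suc n \<le> \<bar>A 0\<bar> + (- (\<Sum>j\<le>n. seg_slope j) / Suc n)"
      by (subst pos_divide_le_eq) auto
    then show "norm (exp (- A (Suc n) / Suc n)) \<le> exp \<bar>A 0\<bar> * exp (- (\<Sum>j\<le>n. seg_slope j) / Suc n)"
      by (simp flip: exp_add)
  qed
  with assms show False
    by contradiction
qed

end

section \<open>The Denjoy--Carleman theorem\<close>

lemma sum_power_over_fact_le_exp:
  fixes y :: real
  assumes "y \<ge> 0"
  shows "(\<Sum>m<k. y ^ m / fact m) \<le> exp y"
proof -
  obtain t where "exp y = (\<Sum>m<k. y ^ m / fact m) + exp t / fact k * y ^ k"
    using Maclaurin_exp_le[of y k] by blast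
  then show ?thesis
    using assms by simp
qed

text \<open>The derivatives are given as a family \<open>F\<close> in which each member is the
  derivative of its predecessor.\<close>

locale smooth_superlinear = superlinear +
  fixes F :: "nat \<Rightarrow> real \<Rightarrow> real"
  assumes deriv_F: "\<And>n x. (F n has_real_derivative F (Suc n) x) (at x)"
    and F_le: "\<And>n x. \<bar>F n x\<bar> \<le> exp (A n)"
begin

text \<open>A level of Bang's norm: the derivatives up to order \<open>q\<close>, divided by
  \<open>exp (n + minorant n)\<close>, are at most \<open>exp (- q)\<close>. At a zero of infinite
  order this holds for every \<open>q\<close>.\<close>

definition small :: "nat \<Rightarrow> real \<Rightarrow> bool" where
  "small q x \<longleftrightarrow> (\<forall>n\<le>q. \<bar>F n x\<bar> \<le> exp (real n - real q + minorant n))"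

text \<open>The location of the intermediate point is dropped, since the bounds \<open>F_le\<close>
  are uniform on the line.\<close>

lemma taylor_F:
  "\<exists>t. F n (x + h) = (\<Sum>m<k. F (n + m) x / fact m * h ^ m) + F (n + k) (x + t) / fact k * h ^ k"
proof -
  have "\<exists>t. \<bar>t\<bar> \<le> \<bar>h\<bar> \<and> F n (x + h) =
      (\<Sum>m<k. F (n + m) (x + 0) / fact m * h ^ m) + F (n + k) (x + t) / fact k * h ^ k"
  proof (rule Maclaurin_all_le[where diff = "\<lambda>m t. F (n + m) (x + t)" and f = "\<lambda>t. F n (x + t)"])
    show "\<forall>m t. ((\<lambda>t. F (n + m) (x + t)) has_real_derivative F (n + Suc m) (x + t)) (at t)"
    proof (intro allI)
      fix m t
      have "((\<lambda>t. F (n + m) (t + x)) has_real_derivative F (Suc (n + m)) (t + x)) (at t)"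
        using deriv_F[of "n + m" "t + x"] by (rule DERIV_shift[THEN iffD1])
      then show "((\<lambda>t. F (n + m) (x + t)) has_real_derivative F (n + Suc m) (x + t)) (at t)"
        by (simp add: add.commute)
    qed
  qed simp
  then show ?thesis
    by auto
qed

text \<open>
  The remainder in Taylor's formula is controlled by the original bound at the vertex \<open>next_vertex p\<close>,
  where the convex minorant agrees with \<open>A\<close>; no convexity of \<open>A\<close> itself is needed.
\<close>

lemma bang_step:
  assumes p: "last_vertex p = p" and small: "small (next_vertex p) x"
    and h: "exp 1 * \<bar>h\<bar> \<le> (real (next_vertex p) - real p) * exp (- seg_slope p)"
  shows "small p (x + h)"
  unfolding small_def
proof (intro allI impI)
  fix n
  assume "n \<le> p"
  define q where "q = next_vertex p"
  define k where "k = q - n"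
  \<comment> \<open>The factor gained with each further derivative: e from the level in
    \<open>small\<close>, the exponential of the slope from the polygon, and
    \<open>\<bar>h\<bar>\<close> from Taylor's formula. The bound on \<open>h\<close> amounts to y
    being at most q - p.\<close>
  define y where "y = exp (1 + seg_slope p) * \<bar>h\<bar>"
  define b where "b = exp (real n - real q + minorant n)"
  have q: "n + k = q" "p < q" "last_vertex q = q"
    using \<open>n \<le> p\<close> next_vertex_gt[of p] last_vertex_next_vertex[OF p] by (auto simp: k_def q_def)
  have y: "y \<ge> 0" "y \<le> real q - real p"
  proof -
    have "y = exp (seg_slope p) * (exp 1 * \<bar>h\<bar>)"
      by (simp add: y_def exp_add)
    also have "\<dots> \<le> exp (seg_slope p) * ((real q - real p) * exp (- seg_slope p))"
      using h by (intro mult_left_mono) (auto simp: q_def)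
    also have "\<dots> = real q - real p"
      by (simp add: exp_minus field_simps)
    finally show "y \<le> real q - real p" .
  qed (simp add: y_def)
  have term_le: "\<bar>z / fact m * h ^ m\<bar> \<le> b * (y ^ m / fact m)"
    if "m \<le> k" "\<bar>z\<bar> \<le> exp (real (n + m) - real q + minorant (n + m))" for m z
  proof -
    have "minorant (n + m) - minorant n \<le> m * seg_slope p"
      using minorant_diff_le[OF p, of n m] that(1) q(1) by (simp add: q_def)
    then have "exp (real (n + m) - real q + minorant (n + m)) \<le> exp (real n - real q + minorant n + real m * (1 + seg_slope p))"
      by (simp add: algebra_simps)
    also have "\<dots> = b * exp (1 + seg_slope p) ^ m"
      by (simp add: b_def exp_add exp_of_nat_mult)
    finally have "\<bar>z\<bar> \<le> b * exp (1 + seg_slope p) ^ m"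
      using that(2) by linarith
    then have "\<bar>z\<bar> * (\<bar>h\<bar> ^ m / fact m) \<le> b * exp (1 + seg_slope p) ^ m * (\<bar>h\<bar> ^ m / fact m)"
      by (intro mult_right_mono) auto
    then show ?thesis
      by (simp add: y_def power_mult_distrib abs_mult power_abs)
  qed
  obtain t where t: "F n (x + h) =
      (\<Sum>m<k. F (n + m) x / fact m * h ^ m) + F (n + k) (x + t) / fact k * h ^ k"
    using taylor_F by blast
  have "\<bar>F n (x + h)\<bar> \<le> (\<Sum>m<k. \<bar>F (n + m) x / fact m * h ^ m\<bar>) + \<bar>F (n + k) (x + t) / fact k * h ^ k\<bar>"
    unfolding t by (intro order_trans[OF abs_triangle_ineq] add_mono sum_abs order_refl)
  also have "\<dots> \<le> (\<Sum>m<k. b * (y ^ m / fact m)) + b * (y ^ k / fact k)"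
  proof (intro add_mono sum_mono term_le)
    fix m
    assume m: "m \<in> {..<k}"
    then have "n + m \<le> q"
      using q(1) by auto
    then show "\<bar>F (n + m) x\<bar> \<le> exp (real (n + m) - real q + minorant (n + m))"
      using small unfolding small_def q_def by blast
    show "m \<le> k"
      using m by simp
  next
    show "\<bar>F (n + k) (x + t)\<bar> \<le> exp (real (n + k) - real q + minorant (n + k))"
      using F_le[of q] q minorant_vertex by simp
  qed simp
  \<comment> \<open>The remainder has become the term m = k of the exponential series; the factor
    \<open>exp (q - p)\<close> obtained below turns level q into level p.\<close>
  also have "\<dots> = b * (\<Sum>m<Suc k. y ^ m / fact m)"
    by (simp add: sum_distrib_left distrib_left)
  also have "\<dots> \<le> b * exp y"
    using y(1) by (intro mult_left_mono sum_power_over_fact_le_exp) (auto simp: b_def)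
  also have "\<dots> \<le> b * exp (real q - real p)"
    using y(2) by (intro mult_left_mono) (auto simp: b_def)
  also have "\<dots> = exp (real n - real p + minorant n)"
    by (simp add: b_def flip: exp_add)
  finally show "\<bar>F n (x + h)\<bar> \<le> exp (real n - real p + minorant n)" .
qed

section \<open>Moving along the chain of vertices\<close>

definition vertex :: "nat \<Rightarrow> nat" where
  "vertex i = (next_vertex ^^ i) 0"

lemma vertex_Suc: "vertex (Suc i) = next_vertex (vertex i)"
  by (simp add: vertex_def)

lemma last_vertex_vertex: "last_vertex (vertex i) = vertex i"
proof (induction i)
  case (Suc i)
  then show ?case
    by (metis last_vertex_next_vertex vertex_Suc)
qed (simp add: vertex_def)

lemma strict_mono_vertex: "strict_mono vertex"
  by (simp add: strict_mono_Suc_iff vertex_Suc next_vertex_gt)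

text \<open>Iterates \<open>bang_step\<close>: every edge between the two vertices pays for a
  displacement of 1 / e times its share of the sum.\<close>

lemma bang_chain:
  assumes "i \<le> j" "small (vertex j) x" "exp 1 * \<bar>h\<bar> \<le> (\<Sum>k=vertex i..<vertex j. exp (- seg_slope k))"
  shows "small (vertex i) (x + h)"
  using assms
proof (induction j arbitrary: x h rule: dec_induct)
  case (step j)
  define a where "a = (\<Sum>k=vertex i..<vertex j. exp (- seg_slope k)) / exp 1"
  \<comment> \<open>\<open>h\<close> clipped to the displacement \<open>a\<close> that the edges
    before \<open>vertex j\<close> can pay for; the last edge covers the rest
    \<open>h - h1\<close>.\<close>
  define h1 where "h1 = max (- a) (min a h)"
  have "a \<ge> 0"
    by (auto simp: a_def intro!: divide_nonneg_pos sum_nonneg)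
  have "vertex i \<le> vertex j" "vertex j \<le> vertex (Suc j)"
    using strict_mono_vertex \<open>i \<le> j\<close> by (auto simp: strict_mono_less_eq)
  then have "(\<Sum>k=vertex i..<vertex (Suc j). exp (- seg_slope k))
      = (\<Sum>k=vertex i..<vertex j. exp (- seg_slope k)) + (\<Sum>k=vertex j..<vertex (Suc j). exp (- seg_slope k))"
    by (simp add: sum.atLeastLessThan_concat)
  also have "(\<Sum>k=vertex i..<vertex j. exp (- seg_slope k)) = exp 1 * a"
    by (simp add: a_def)
  finally have "exp 1 * (\<bar>h\<bar> - a) \<le> (\<Sum>k=vertex j..<vertex (Suc j). exp (- seg_slope k))"
    using step.prems(2) by (simp add: algebra_simps)
  moreover have "\<bar>h - h1\<bar> \<le> max 0 (\<bar>h\<bar> - a)"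
    using \<open>a \<ge> 0\<close> by (auto simp: h1_def)
  then have "exp 1 * \<bar>h - h1\<bar> \<le> max 0 (exp 1 * (\<bar>h\<bar> - a))"
    by (auto simp: max_def zero_le_mult_iff split: if_splits)
  moreover have "(\<Sum>k=vertex j..<vertex (Suc j). exp (- seg_slope k)) \<ge> 0"
    by (intro sum_nonneg) auto
  ultimately have "exp 1 * \<bar>h - h1\<bar> \<le> (\<Sum>k=vertex j..<vertex (Suc j). exp (- seg_slope k))"
    by linarith
  then have "exp 1 * \<bar>h - h1\<bar> \<le> (real (next_vertex (vertex j)) - real (vertex j)) * exp (- seg_slope (vertex j))"
    by (simp add: vertex_Suc sum_exp_seg_slope_vertex last_vertex_vertex)
  then have "small (vertex j) (x + (h - h1))"
    using step.prems(1) by (intro bang_step last_vertex_vertex) (auto simp: vertex_Suc)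
  moreover have "\<bar>h1\<bar> \<le> a"
    using \<open>a \<ge> 0\<close> by (auto simp: h1_def)
  then have "exp 1 * \<bar>h1\<bar> \<le> (\<Sum>k=vertex i..<vertex j. exp (- seg_slope k))"
    by (simp add: a_def field_simps)
  ultimately show ?case
    using step.IH[of "x + (h - h1)" h1] by simp
\<comment> \<open>In the base case the sum is empty, which forces h = 0.\<close>
qed (simp add: mult_le_0_iff)

text \<open>All levels are small at 0. As the slope series diverges, a start at a high enough vertex
  allows \<open>x\<close> to be reached while still at level \<open>vertex i\<close>, for any
  prescribed i; letting i grow forces the value to vanish.\<close>

lemma eq_0_of_flat:
  assumes flat: "\<And>n. F n 0 = 0" and div: "\<not> summable (\<lambda>n. exp (- A (Suc n) / Suc n))"
  shows "F 0 x = 0"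
proof (rule ccontr)
  assume "F 0 x \<noteq> 0"
  \<comment> \<open>Chosen so that \<open>exp (minorant 0 - i)\<close> is below
    \<open>\<bar>F 0 x\<bar>\<close>.\<close>
  obtain i :: nat where i: "real i > minorant 0 - ln \<bar>F 0 x\<bar>"
    using reals_Archimedean2 by blast
  have "\<exists>j\<ge>i. exp 1 * \<bar>x\<bar> \<le> (\<Sum>k=vertex i..<vertex j. exp (- seg_slope k))"
  proof (rule ccontr)
    assume *: "\<not> (\<exists>j\<ge>i. exp 1 * \<bar>x\<bar> \<le> (\<Sum>k=vertex i..<vertex j. exp (- seg_slope k)))"
    have "summable (\<lambda>k. exp (- seg_slope k))"
    proof (rule bounded_imp_summable)
      fix N
      define j where "j = max i (Suc N)"
      have "Suc N \<le> vertex j" "vertex i \<le> vertex j"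
        using strict_mono_imp_increasing[OF strict_mono_vertex, of j] strict_mono_vertex
        by (auto simp: j_def strict_mono_less_eq)
      have "(\<Sum>k\<le>N. exp (- seg_slope k)) \<le> (\<Sum>k=0..<vertex j. exp (- seg_slope k))"
        using \<open>Suc N \<le> vertex j\<close> by (intro sum_mono2) auto
      also have "\<dots> = (\<Sum>k=0..<vertex i. exp (- seg_slope k)) + (\<Sum>k=vertex i..<vertex j. exp (- seg_slope k))"
        using \<open>vertex i \<le> vertex j\<close> by (simp add: sum.atLeastLessThan_concat)
      also have "\<dots> \<le> (\<Sum>k=0..<vertex i. exp (- seg_slope k)) + exp 1 * \<bar>x\<bar>"
      proof -
        have "i \<le> j"
          by (simp add: j_def)
        with * show ?thesis
          by force
      qed
      finally show "(\<Sum>k\<le>N. exp (- seg_slope k)) \<le> (\<Sum>k=0..<vertex i. exp (- seg_slope k)) + exp 1 * \<bar>x\<bar>" .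
    qed simp
    with not_summable_exp_slopes[OF div] show False
      by contradiction
  qed
  then obtain j where j: "j \<ge> i" "exp 1 * \<bar>x\<bar> \<le> (\<Sum>k=vertex i..<vertex j. exp (- seg_slope k))"
    by blast
  have "small (vertex j) 0"
    by (simp add: small_def flat)
  then have "small (vertex i) (0 + x)"
    using j by (intro bang_chain[where j = j])
  then have "\<bar>F 0 x\<bar> \<le> exp (minorant 0 - real (vertex i))"
    by (auto simp: small_def)
  also have "\<dots> \<le> exp (minorant 0 - real i)"
    using strict_mono_imp_increasing[OF strict_mono_vertex, of i] by simp
  also have "\<dots> < exp (ln \<bar>F 0 x\<bar>)"
    using i by simp
  finally show False
    using \<open>F 0 x \<noteq> 0\<close> by simp
qed

end

text \<open>If \<open>ln M\<close> is superlinear, Bang's method applies. Otherwise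
  \<open>M n\<close> is at most \<open>exp (K * n)\<close> for infinitely many n, and along these
  the Taylor remainder at 0 tends to 0.\<close>

lemma denjoy_carleman_sequence:
  fixes F :: "nat \<Rightarrow> real \<Rightarrow> real"
  assumes deriv_F: "\<And>n x. (F n has_real_derivative F (Suc n) x) (at x)"
    and F_le: "\<And>n x. \<bar>F n x\<bar> \<le> M n" and M_pos: "\<And>n. M n > 0"
    and flat: "\<And>n. F n 0 = 0"
    and div: "\<not> summable (\<lambda>n. 1 / root (Suc n) (M (Suc n)))"
  shows "F 0 x = 0"
proof (cases "\<forall>K. eventually (\<lambda>n. ln (M n) > K * real n) sequentially")
  case True
  interpret smooth_superlinear "\<lambda>n. ln (M n)" F
    using True deriv_F F_le M_pos by unfold_locales auto
  have "exp (- ln (M (Suc n)) / Suc n) = 1 / root (Suc n) (M (Suc n))" for n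
  proof -
    have "root (Suc n) (M (Suc n)) = exp (ln (M (Suc n)) / Suc n)"
      using M_pos[of "Suc n"] by (simp del: of_nat_Suc flip: ln_root)
    then show ?thesis
      by (simp add: exp_minus field_simps)
  qed
  then show ?thesis
    using flat div by (intro eq_0_of_flat) auto
next
  case False
  then obtain K where "\<not> eventually (\<lambda>n. ln (M n) > K * real n) sequentially"
    by blast
  then have freq: "frequently (\<lambda>n. ln (M n) \<le> K * real n) sequentially"
    by (simp add: frequently_def not_le)
  show ?thesis
  proof (rule ccontr)
    assume "F 0 x \<noteq> 0"
    define y where "y = exp K * \<bar>x\<bar>"
    have "(\<lambda>n. inverse (fact n) * y ^ n) \<longlonglongrightarrow> 0"
      by (rule summable_LIMSEQ_zero[OF summable_exp])
    then have "eventually (\<lambda>n. inverse (fact n) * y ^ n < \<bar>F 0 x\<bar>) sequentially"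
      using \<open>F 0 x \<noteq> 0\<close> by (intro order_tendstoD) auto
    then obtain n where n: "ln (M n) \<le> K * real n" "inverse (fact n) * y ^ n < \<bar>F 0 x\<bar>"
      using frequently_eventually_frequently[OF freq] frequently_ex by blast
    obtain t where "F 0 x = (\<Sum>m<n. F m 0 / fact m * x ^ m) + F n t / fact n * x ^ n"
      using Maclaurin_all_le[of F "F 0" x n] deriv_F by auto
    then have "\<bar>F 0 x\<bar> = \<bar>F n t\<bar> * (\<bar>x\<bar> ^ n / fact n)"
      by (simp add: flat abs_mult power_abs)
    also have "\<dots> \<le> exp (K * n) * (\<bar>x\<bar> ^ n / fact n)"
    proof (rule mult_right_mono)
      have "M n = exp (ln (M n))"
        using M_pos by simp
      also have "\<dots> \<le> exp (K * n)"
        using n(1) by simp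
      finally show "\<bar>F n t\<bar> \<le> exp (K * n)"
        using F_le[of n t] by simp
    qed simp
    also have "\<dots> = inverse (fact n) * y ^ n"
      by (simp add: y_def power_mult_distrib exp_of_nat2_mult divide_inverse)
    finally show False
      using n(2) by simp
  qed
qed

text \<open>The constants of the class change the roots by at most the factor
  \<open>max 1 \<beta> * B\<close>, so divergence survives. It is demanded only for positive
  \<open>M\<close>: if some \<open>M n\<close> is 0, the n-th derivative vanishes and Taylor's
  formula at 0 gives f = 0.\<close>

theorem denjoy_carleman:
  assumes M_nonneg: "\<And>n. M n \<ge> 0"
    and div: "(\<And>n. M n > 0) \<Longrightarrow> \<not> summable (\<lambda>n. 1 / root (Suc n) (M (Suc n)))"
  shows "quasi_analytic M"
  unfolding quasi_analytic_def
proof (intro ballI impI allI)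
  fix f :: "real \<Rightarrow> real" and x :: real
  assume "f \<in> carleman_class M" and flat: "\<forall>n. (deriv ^^ n) f 0 = 0"
  then obtain \<beta> B where smooth: "\<And>n x. ((deriv ^^ n) f) field_differentiable (at x)"
    and "\<beta> > 0" "B > 0" and bound: "\<And>n x. \<bar>(deriv ^^ n) f x\<bar> \<le> \<beta> * B ^ n * M n"
    unfolding carleman_class_def by blast
  have deriv_f: "((deriv ^^ n) f has_real_derivative (deriv ^^ Suc n) f x) (at x)" for n x
    using smooth[of n x] by (simp add: field_differentiable_derivI)
  show "f x = 0"
  proof (cases "\<forall>n. M n > 0")
    case True
    have "(deriv ^^ 0) f x = 0"
    proof (rule denjoy_carleman_sequence[where F = "\<lambda>n. (deriv ^^ n) f"])
      show "\<not> summable (\<lambda>n. 1 / root (Suc n) (\<beta> * B ^ Suc n * M (Suc n)))"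
      proof
        assume *: "summable (\<lambda>n. 1 / root (Suc n) (\<beta> * B ^ Suc n * M (Suc n)))"
        define b where "b = max 1 \<beta>"
        have root_le: "root (Suc n) \<beta> \<le> b" for n
        proof -
          have "\<beta> \<le> b" "b \<ge> 1"
            by (auto simp: b_def)
          then have "\<beta> \<le> b ^ Suc n"
            using self_le_power[of b "Suc n"] by (simp del: power_Suc)
          then have "root (Suc n) \<beta> \<le> root (Suc n) (b ^ Suc n)"
            by (intro real_root_le_mono) auto
          also have "\<dots> = b"
            using \<open>b \<ge> 1\<close> by (intro real_root_power_cancel) auto
          finally show ?thesis .
        qed
        have "summable (\<lambda>n. b * B * (1 / root (Suc n) (\<beta> * B ^ Suc n * M (Suc n))))"
          using * by (rule summable_mult)
        then have "summable (\<lambda>n. 1 / root (Suc n) (M (Suc n)))"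
        proof (rule summable_comparison_test'[where N = 0])
          fix n
          define r where "r = root (Suc n) (M (Suc n))"
          have "r > 0"
            using True by (simp add: r_def)
          have eq: "root (Suc n) (\<beta> * B ^ Suc n * M (Suc n)) = root (Suc n) \<beta> * B * r"
            using real_root_power_cancel[of "Suc n" B] \<open>B > 0\<close>
            by (simp add: real_root_mult r_def del: power_Suc)
          have "root (Suc n) \<beta> > 0"
            using \<open>\<beta> > 0\<close> by simp
          then have "1 / r \<le> b * B * (1 / (root (Suc n) \<beta> * B * r))"
            using root_le[of n] \<open>r > 0\<close> \<open>B > 0\<close> by (simp add: field_simps)
          then show "norm (1 / root (Suc n) (M (Suc n))) \<le> b * B * (1 / root (Suc n) (\<beta> * B ^ Suc n * M (Suc n)))"
            unfolding eq using \<open>r > 0\<close> by (simp add: r_def)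
        qed
        with div True show False
          by blast
      qed
    qed (use True \<open>\<beta> > 0\<close> \<open>B > 0\<close> bound flat deriv_f in auto)
    then show ?thesis
      by simp
  next
    case False
    then obtain n where "M n = 0"
      using M_nonneg by (force simp: not_less intro: antisym)
    then have "(deriv ^^ n) f t = 0" for t
      using bound[of n t] by simp
    moreover obtain t where
      "f x = (\<Sum>m<n. (deriv ^^ m) f 0 / fact m * x ^ m) + (deriv ^^ n) f t / fact n * x ^ n"
      using Maclaurin_all_le[of "\<lambda>n. (deriv ^^ n) f" f x n] deriv_f by auto
    ultimately show ?thesis
      using flat by simp
  qed
qed

section \<open>Total sets of test functions\<close>

lemma partial_deriv_cmult:
  assumes "f differentiable (at x)"
  shows "partial_deriv i (\<lambda>x. c * f x) x = c * partial_deriv i f x"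
proof -
  have "((\<lambda>x. c * f x) has_derivative (\<lambda>h. c * frechet_derivative f (at x) h)) (at x)"
    using assms by (intro has_derivative_mult_right) (simp add: frechet_derivative_works)
  then show ?thesis
    unfolding partial_deriv_def by (simp flip: frechet_derivative_at)
qed

lemma C_k_cmult: "C_k n f \<Longrightarrow> C_k n (\<lambda>x. c * f x)"
proof (induction n arbitrary: f)
  case (Suc n)
  then have "partial_deriv i (\<lambda>x. c * f x) = (\<lambda>x. c * partial_deriv i f x)" for i
    by (auto intro: partial_deriv_cmult)
  then show ?case
    using Suc by (auto intro!: differentiable_mult)
qed (simp add: continuous_on_mult_left)

lemma C_infinity_c_cmult:
  assumes "f \<in> C_infinity_c" "c \<noteq> 0"
  shows "(\<lambda>x. c * f x) \<in> C_infinity_c"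
  using assms by (auto simp: C_infinity_c_def C_infinity_def C_k_cmult)

lemma C_infinity_continuous: "f \<in> C_infinity \<Longrightarrow> continuous_on UNIV f"
  by (simp add: C_infinity_def) (metis C_k.simps(1))

lemma C_k_const: "C_k n (\<lambda>x. c)"
  by (induction n arbitrary: c) (auto simp: partial_deriv_def)

lemma mi_deriv_zero_fun: "mi_deriv \<beta> (\<lambda>x. 0) = (\<lambda>x. 0)"
proof -
  have "foldr partial_deriv is (\<lambda>x. 0) = (\<lambda>x. 0)" for "is" :: "'a list"
    by (induction "is") (auto simp: partial_deriv_def)
  then show ?thesis
    by (simp add: mi_deriv_def)
qed

text \<open>Only the empty list has all counts zero, so the choice in \<open>mi_list\<close> is
  determined here. This yields \<open>tk \<ge> k\<^sup>2\<close> from the hypothesis on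
  derivatives.\<close>

lemma mi_deriv_0: "mi_deriv (\<lambda>i. 0) f = f"
proof -
  have "\<forall>i. count_list (mi_list (\<lambda>i::'a. 0)) i = 0"
    unfolding mi_list_def by (rule someI_ex[OF ex_mi_list])
  then have "mi_list (\<lambda>i::'a. 0) = []"
    by (metis count_list_0_iff list.set_intros(1) neq_Nil_conv)
  then show ?thesis
    by (simp add: mi_deriv_def)
qed

lemma topspace_D_topology: "topspace D_topology = (C_infinity_c :: (real ^ 'd::finite \<Rightarrow> real) set)"
proof
  show "topspace D_topology \<subseteq> (C_infinity_c :: (real ^ 'd \<Rightarrow> real) set)"
    by (auto simp: D_topology_def sobolev_ball_def)
  show "(C_infinity_c :: (real ^ 'd \<Rightarrow> real) set) \<subseteq> topspace D_topology"
  proof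
    fix \<phi> :: "real ^ 'd \<Rightarrow> real"
    assume \<phi>: "\<phi> \<in> C_infinity_c"
    have "(0, \<lambda>r. 1) \<in> (sobolev_index :: (nat \<times> (real ^ 'd \<Rightarrow> real)) set)"
      by (auto simp: sobolev_index_def C_infinity_def C_k_const)
    moreover have "\<phi> \<in> sobolev_ball (0, \<lambda>r. 1) \<phi> 1"
      using \<phi> by (simp add: sobolev_ball_def sobolev_norm_def mi_deriv_zero_fun)
    ultimately show "\<phi> \<in> topspace D_topology"
      unfolding D_topology_def topology_generated_by_topspace using \<phi> zero_less_one by blast
  qed
qed

text \<open>The span is already the whole space, so its closure is found without any estimate of
  Sobolev norms.\<close>

lemma total_in_D_if_absorbing:
  assumes "E \<subseteq> C_infinity_c" and absorb: "\<And>\<phi>. \<phi> \<in> C_infinity_c \<Longrightarrow> \<exists>c\<noteq>0. (\<lambda>r. c * \<phi> r) \<in> E"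
  shows "total_in_D E"
proof -
  have "C_infinity_c \<subseteq> linear_span E"
  proof
    fix \<phi> :: "real ^ 'a \<Rightarrow> real"
    assume "\<phi> \<in> C_infinity_c"
    then obtain c where c: "c \<noteq> 0" "(\<lambda>r. c * \<phi> r) \<in> E"
      using absorb by blast
    have "\<phi> = (\<lambda>x. \<Sum>f\<in>{\<lambda>r. c * \<phi> r}. (1 / c) * f x)"
      using c by simp
    moreover have "finite {\<lambda>r. c * \<phi> r}" "{\<lambda>r. c * \<phi> r} \<subseteq> E"
      using c by auto
    ultimately show "\<phi> \<in> linear_span E"
      unfolding linear_span_def mem_Collect_eq
      by (intro exI[of _ "{\<lambda>r. c * \<phi> r}"] exI[of _ "\<lambda>_. 1 / c"]) blast
  qed
  then have "D_topology closure_of (linear_span E) = C_infinity_c"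
    using closure_of_subset_Int[of D_topology "linear_span E"] closure_of_subset_topspace[of D_topology "linear_span E"]
    by (auto simp: topspace_D_topology)
  then show ?thesis
    using assms(1) by (simp add: total_in_D_def)
qed

section \<open>Scaling a test function against all weights at once\<close>

lemma continuous_bounded_if_vanishes_outside:
  fixes g :: "'a::heine_borel \<Rightarrow> real"
  assumes "continuous_on UNIV g" "bounded S" "\<And>x. x \<notin> S \<Longrightarrow> g x = 0"
  shows "\<exists>G\<ge>0. \<forall>x. \<bar>g x\<bar> \<le> G"
proof -
  have "compact (closure S)"
    using assms(2) by (simp add: compact_closure)
  then have "compact (g ` closure S)"
    by (rule compact_continuous_image[OF continuous_on_subset[OF assms(1) subset_UNIV]])
  then have "bounded (g ` closure S)"
    by (rule compact_imp_bounded)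
  then obtain G where G: "\<And>x. x \<in> closure S \<Longrightarrow> \<bar>g x\<bar> \<le> G"
    unfolding bounded_iff by force
  have "\<bar>g x\<bar> \<le> max 0 G" for x
    using G[of x] assms(3)[of x] closure_subset[of S] by force
  then show ?thesis
    by (intro exI[of _ "max 0 G"]) auto
qed

text \<open>
  Only the finitely many weights whose index lies below the radius of the support impose a
  genuine constraint on the scaling factor; for the others the support lies in the ball on
  which the bound is valid.
\<close>

lemma ex_scaling:
  fixes \<phi> :: "'a::euclidean_space \<Rightarrow> real" and w :: "nat \<Rightarrow> 'a \<Rightarrow> real"
  assumes \<phi>: "continuous_on UNIV \<phi>" "compact (closure {x. \<phi> x \<noteq> 0})"
    and w: "\<And>n. n \<ge> 1 \<Longrightarrow> continuous_on UNIV (w n)" "\<And>n x. n \<ge> 1 \<Longrightarrow> w n x \<ge> 0"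
    and b: "\<And>n x. n \<ge> 1 \<Longrightarrow> norm x \<le> real n \<Longrightarrow> w n x \<le> b n" "\<And>n. n \<ge> 1 \<Longrightarrow> b n \<ge> 1"
  shows "\<exists>c>0. \<forall>n\<ge>1. \<forall>x. \<bar>c * \<phi> x\<bar> * w n x \<le> b n"
proof -
  define S where "S = {x. \<phi> x \<noteq> 0}"
  have S: "bounded S" "\<And>x. x \<notin> S \<Longrightarrow> \<phi> x = 0"
    using \<phi>(2) bounded_subset[OF compact_imp_bounded closure_subset] by (auto simp: S_def)
  obtain R where R: "\<And>x. x \<in> S \<Longrightarrow> norm x \<le> R"
    using S(1) by (auto simp: bounded_iff)
  obtain N :: nat where N: "R \<le> real N"
    using real_arch_simple by blast
  obtain G0 where G0: "G0 \<ge> 0" "\<And>x. \<bar>\<phi> x\<bar> \<le> G0"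
    using continuous_bounded_if_vanishes_outside[OF \<phi>(1) S] by blast
  have "\<exists>G\<ge>0. \<forall>x. \<bar>\<phi> x * w n x\<bar> \<le> G" if "n \<ge> 1" for n
    using that S by (intro continuous_bounded_if_vanishes_outside[of _ S] continuous_on_mult \<phi> w) auto
  then obtain G where G: "\<And>n. n \<ge> 1 \<Longrightarrow> G n \<ge> 0" "\<And>n x. n \<ge> 1 \<Longrightarrow> \<bar>\<phi> x * w n x\<bar> \<le> G n"
    by metis
  \<comment> \<open>The sum handles the indices up to \<open>N\<close>, \<open>G0\<close> handles
    the later ones, whose ball contains the support, and 1 keeps \<open>D\<close> positive.\<close>
  define D where "D = 1 + G0 + (\<Sum>n=1..N. G n)"
  have sum_nonneg: "(\<Sum>n=1..N. G n) \<ge> 0"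
    using G(1) by (intro sum_nonneg) auto
  have D: "D > 0" "D \<ge> G0" "\<And>n. 1 \<le> n \<Longrightarrow> n \<le> N \<Longrightarrow> D \<ge> G n"
  proof -
    fix n
    assume "1 \<le> n" "n \<le> N"
    then have "G n \<le> (\<Sum>n=1..N. G n)"
      using G(1) by (intro member_le_sum) auto
    then show "D \<ge> G n"
      using G0(1) by (simp add: D_def)
  qed (use G0(1) sum_nonneg in \<open>auto simp: D_def\<close>)
  have "\<bar>\<phi> x\<bar> * w n x \<le> D * b n" if n: "n \<ge> 1" for n x
  proof (cases "n \<le> N")
    case True
    have "\<bar>\<phi> x\<bar> * w n x \<le> G n"
      using G(2)[OF n, of x] w(2)[OF n, of x] by (simp add: abs_mult)
    also have "\<dots> \<le> D * 1"
      using D(3)[OF n True] by simp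
    also have "\<dots> \<le> D * b n"
      using D(1) b(2)[OF n] by (intro mult_left_mono) auto
    finally show ?thesis .
  next
    case False
    show ?thesis
    proof (cases "x \<in> S")
      case True
      then have "norm x \<le> real n"
        using R[of x] N False by simp
      then show ?thesis
        using G0(2)[of x] D(1,2) b(1)[OF n] w(2)[OF n] by (intro mult_mono) (auto intro: order_trans)
    next
      case False
      then show ?thesis
        using S(2)[of x] D(1) b(2)[OF n] by simp
    qed
  qed
  then have "\<bar>(1 / D) * \<phi> x\<bar> * w n x \<le> b n" if "n \<ge> 1" for n x
    using that D(1) by (simp add: abs_mult field_simps)
  then show ?thesis
    using D(1) by (intro exI[of _ "1 / D"]) auto
qed

lemma abs_integral_prod_le:
  fixes f :: "nat \<Rightarrow> 'a::topological_space \<Rightarrow> real" and w :: "'a \<Rightarrow> real"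
  assumes sets: "sets M = sets (\<Pi>\<^sub>M i\<in>{..<N}. borel)" and w: "w \<in> borel_measurable borel" "\<And>r. w r > 0"
    and f: "\<And>i r. i < N \<Longrightarrow> \<bar>f i r\<bar> * w r \<le> b" and "b \<ge> 0"
  shows "ennreal \<bar>\<integral>x. (\<Prod>i<N. f i (x i)) \<partial>M\<bar>
    \<le> ennreal (b ^ N) * (\<integral>\<^sup>+x. ennreal (1 / (\<Prod>i<N. w (x i))) \<partial>M)"
proof (cases "integrable M (\<lambda>x. \<Prod>i<N. f i (x i))")
  case True
  have "(\<lambda>x. w (x i)) \<in> borel_measurable M" if "i \<in> {..<N}" for i
    unfolding measurable_cong_sets[OF sets refl]
    by (rule measurable_compose[OF measurable_component_singleton[OF that] w(1)])
  then have [measurable]: "(\<lambda>x. \<Prod>i<N. w (x i)) \<in> borel_measurable M"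
    by (rule borel_measurable_prod)
  have "ennreal \<bar>\<integral>x. (\<Prod>i<N. f i (x i)) \<partial>M\<bar> \<le> (\<integral>\<^sup>+x. ennreal \<bar>\<Prod>i<N. f i (x i)\<bar> \<partial>M)"
    using integral_norm_bound_ennreal[OF True] by simp
  also have "\<dots> \<le> (\<integral>\<^sup>+x. ennreal (b ^ N) * ennreal (1 / (\<Prod>i<N. w (x i))) \<partial>M)"
  proof (rule nn_integral_mono)
    fix x
    have "\<bar>\<Prod>i<N. f i (x i)\<bar> \<le> (\<Prod>i<N. b / w (x i))"
      unfolding abs_prod using f w(2) by (intro prod_mono) (auto simp: pos_le_divide_eq)
    also have "\<dots> = b ^ N * (1 / (\<Prod>i<N. w (x i)))"
      by (simp add: prod_dividef)
    finally show "ennreal \<bar>\<Prod>i<N. f i (x i)\<bar> \<le> ennreal (b ^ N) * ennreal (1 / (\<Prod>i<N. w (x i)))"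
      using \<open>b \<ge> 0\<close> w(2) by (auto simp: ennreal_mult'[symmetric] intro!: ennreal_leI)
  qed
  also have "\<dots> = ennreal (b ^ N) * (\<integral>\<^sup>+x. ennreal (1 / (\<Prod>i<N. w (x i))) \<partial>M)"
    by (rule nn_integral_cmult) measurable
  finally show ?thesis .
\<comment> \<open>A non-integrable product has Bochner integral 0 by convention.\<close>
qed (simp add: not_integrable_integral_eq)

section \<open>Order properties of extended non-negative numbers\<close>

lemma ennreal_inverse_antimono:
  fixes a b :: ennreal
  assumes "a \<le> b"
  shows "inverse b \<le> inverse a"
proof (cases "a = 0 \<or> b = top")
  case False
  with assms obtain x y where xy: "a = ennreal x" "b = ennreal y" "0 < x" "x \<le> y"
    by (cases a; cases b) (auto simp: less_le top_unique)
  then have "inverse y \<le> inverse x"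
    by simp
  with xy show ?thesis
    by (simp add: inverse_ennreal ennreal_leI)
qed auto

lemma ennroot_mono: "n > 0 \<Longrightarrow> x \<le> y \<Longrightarrow> ennroot n x \<le> ennroot n y"
  by (auto simp: ennroot_def top_unique less_top intro!: ennreal_leI real_root_le_mono enn2real_mono)

theorem proposition4p5:
  fixes m :: "nat \<Rightarrow> (nat \<Rightarrow> real ^ 'd::finite) measure"
    and k tk :: "nat \<Rightarrow> real ^ 'd \<Rightarrow> real"
  assumes "radon_sequence m"
    and "\<And>n. n \<ge> 1 \<Longrightarrow> k n \<in> C_infinity"
    and "\<And>n. n \<ge> 1 \<Longrightarrow> tk n \<in> C_infinity"
    and "\<And>n r. n \<ge> 1 \<Longrightarrow> k n r \<ge> 1"
    and "\<And>n r \<kappa>. n \<ge> 1 \<Longrightarrow> mi_order \<kappa> \<le> nat \<lceil>(real CARD('d) + 1) / 2\<rceil> \<Longrightarrow>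
           tk n r \<ge> \<bar>mi_deriv \<kappa> (k n) r\<bar>\<^sup>2"
    and "(\<Sum>j. let n = Suc j in
            1 / ((SUP z \<in> {z. norm z \<le> real n}. SUP x \<in> {x. \<forall>i. x $ i \<in> {-1..1}}.
                    ennreal (sqrt (tk (2 * n) (z + x))))
                 * ennroot (2 * n) (weighted_moment m k n))) = (\<infinity> :: ennreal)"
    and "\<And>n. weighted_moment m k n < \<infinity>"
  shows "determining m"
proof -
  define w where "w n = k (2 * n)" for n
  define W where "W n = enn2real (weighted_moment m k n)" for n
  define S where "S n = (SUP z \<in> {z. norm z \<le> real n}. SUP x \<in> {x. \<forall>i. x $ i \<in> {-1..1}}.
    ennreal (sqrt (tk (2 * n) (z + x))))" for n
  have w_cont: "continuous_on UNIV (w n)" and w_ge: "w n x \<ge> 1" if "n \<ge> 1" for n x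
    using assms(2,4)[of "2 * n"] that by (auto simp: w_def C_infinity_continuous)
  have wm_eq: "weighted_moment m k n = ennreal (W n)" for n
    using assms(7)[of n] by (simp add: W_def)
  have W_nonneg: "W n \<ge> 0" for n
    by (simp add: W_def)
  \<comment> \<open>The maximum over the compact ball is attained; a maximiser is kept as a point at
    which the supremum \<open>S n\<close> can be tested.\<close>
  have "\<exists>z\<in>cball 0 (real n). \<forall>x\<in>cball 0 (real n). w n x \<le> w n z" if "n \<ge> 1" for n
    using w_cont[OF that] by (intro continuous_attains_sup) (auto intro: continuous_on_subset)
  then obtain z where z: "\<And>n. n \<ge> 1 \<Longrightarrow> norm (z n) \<le> real n"
      "\<And>n x. n \<ge> 1 \<Longrightarrow> norm x \<le> real n \<Longrightarrow> w n x \<le> w n (z n)"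
    by (metis mem_cball_0)
  define b where "b n = w n (z n)" for n
  have b_ge: "b n \<ge> 1" if "n \<ge> 1" for n
    using w_ge[OF that] by (simp add: b_def)
  \<comment> \<open>Multi-index 0 bounds \<open>k\<close> by the root of \<open>tk\<close>; the
    double supremum is then tested at \<open>z n\<close> and x = 0.\<close>
  have b_le_S: "ennreal (b n) \<le> S n" if "n \<ge> 1" for n
  proof -
    have "tk (2 * n) (z n) \<ge> (b n)\<^sup>2"
      using assms(5)[of "2 * n" "\<lambda>i. 0" "z n"] that
      by (simp add: mi_order_def mi_deriv_0 b_def w_def)
    then have "b n \<le> sqrt (tk (2 * n) (z n + 0))"
      by (simp add: real_le_rsqrt)
    then show ?thesis
      unfolding S_def using z(1)[OF that]
      by (intro SUP_upper2[of "z n"] SUP_upper2[of "0 :: real ^ 'd"] ennreal_leI) auto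
  qed
  define E where "E = {\<psi> \<in> C_infinity_c. \<forall>n\<ge>1. \<forall>x. \<bar>\<psi> x\<bar> * w n x \<le> b n}"
  have total: "total_in_D E"
  proof (rule total_in_D_if_absorbing)
    fix \<phi> :: "real ^ 'd \<Rightarrow> real"
    assume \<phi>: "\<phi> \<in> C_infinity_c"
    have "\<exists>c>0. \<forall>n\<ge>1. \<forall>x. \<bar>c * \<phi> x\<bar> * w n x \<le> b n"
    proof (rule ex_scaling)
      show "continuous_on UNIV \<phi>" "compact (closure {x. \<phi> x \<noteq> 0})"
        using \<phi> by (auto simp: C_infinity_c_def C_infinity_continuous)
      show "w n x \<ge> 0" if "n \<ge> 1" for n x
        using w_ge[OF that, of x] by simp
    qed (use w_cont z(2) b_ge in \<open>auto simp: b_def\<close>)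
    then obtain c where "c > 0" "\<forall>n\<ge>1. \<forall>x. \<bar>c * \<phi> x\<bar> * w n x \<le> b n"
      by blast
    then show "\<exists>c\<noteq>0. (\<lambda>r. c * \<phi> r) \<in> E"
      using \<phi> by (intro exI[of _ c]) (auto simp: E_def C_infinity_c_cmult)
  qed (auto simp: E_def)
  \<comment> \<open>Each of the 2n factors contributes \<open>b n\<close>, and the square root in
    the definition of the coefficient halves the exponent.\<close>
  have coeff_le: "det_coeff m E n \<le> ennreal (b n ^ n * sqrt (W n))" if n: "n \<ge> 1" for n
  proof -
    have "ennreal \<bar>\<integral>x. (\<Prod>i<2 * n. f i (x i)) \<partial>m (2 * n)\<bar> \<le> ennreal (b n ^ (2 * n) * W n)"
      if f: "f \<in> {..<2 * n} \<rightarrow> E" for f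
    proof -
      have "ennreal \<bar>\<integral>x. (\<Prod>i<2 * n. f i (x i)) \<partial>m (2 * n)\<bar>
          \<le> ennreal (b n ^ (2 * n)) * (\<integral>\<^sup>+x. ennreal (1 / (\<Prod>i<2 * n. w n (x i))) \<partial>m (2 * n))"
      proof (rule abs_integral_prod_le)
        show "sets (m (2 * n)) = sets (product_borel (2 * n))"
          using assms(1) by (simp add: radon_sequence_def radon_measure_def)
        show "w n \<in> borel_measurable borel"
          using w_cont[OF n] by (rule borel_measurable_continuous_onI)
        show "w n r > 0" for r
          using w_ge[OF n, of r] by simp
        show "\<bar>f i r\<bar> * w n r \<le> b n" if "i < 2 * n" for i r
          using Pi_mem[OF f, of i] that n by (simp add: E_def)
        show "b n \<ge> 0"
          using b_ge[OF n] by simp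
      qed
      also have "\<dots> = ennreal (b n ^ (2 * n) * W n)"
        using b_ge[OF n] by (simp add: ennreal_mult wm_eq[unfolded weighted_moment_def] W_def w_def)
      finally show ?thesis .
    qed
    then have "det_coeff m E n \<le> ennroot 2 (ennreal (b n ^ (2 * n) * W n))"
      using n unfolding det_coeff_def by (auto intro!: ennroot_mono SUP_least)
    also have "\<dots> = ennreal (b n ^ n * sqrt (W n))"
      using b_ge[OF n] by (simp add: ennroot_def W_def sqrt_def[symmetric] real_sqrt_mult power_even_eq)
    finally show ?thesis .
  qed
  define M where "M n = enn2real (det_coeff m E n)" for n
  have coeff_finite: "det_coeff m E n < \<infinity>" for n
  proof (cases "n \<ge> 1")
    case True
    then show ?thesis
      using coeff_le[OF True] by (simp add: le_less_trans)
  next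
    case False
    then show ?thesis
      by (simp add: det_coeff_def)
  qed
  have "quasi_analytic M"
  proof (rule denjoy_carleman)
    assume M_pos: "\<And>n. M n > 0"
    show "\<not> summable (\<lambda>j. 1 / root (Suc j) (M (Suc j)))"
    proof
      assume summable: "summable (\<lambda>j. 1 / root (Suc j) (M (Suc j)))"
      \<comment> \<open>Taking n-th roots in \<open>coeff_le\<close> turns the square root of the
        moment into its 2n-th root, so each given term is dominated by a term of the
        Denjoy--Carleman series.\<close>
      have term_le: "1 / (S n * ennroot (2 * n) (weighted_moment m k n)) \<le> ennreal (1 / root n (M n))"
        if n: "n \<ge> 1" for n
      proof -
        have "root n (M n) \<le> root n (b n ^ n * sqrt (W n))"
          using coeff_le[OF n] b_ge[OF n] n
          by (intro real_root_le_mono) (auto simp: M_def W_def intro!: enn2real_leI)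
        also have "\<dots> = b n * root (2 * n) (W n)"
          using b_ge[OF n] n
          by (simp add: real_root_mult real_root_power_cancel sqrt_def real_root_mult_exp mult.commute[of 2])
        finally have "ennreal (root n (M n)) \<le> ennreal (b n) * ennreal (root (2 * n) (W n))"
          using b_ge[OF n] by (subst ennreal_mult'[symmetric]) (auto intro!: ennreal_leI)
        also have "\<dots> \<le> S n * ennroot (2 * n) (weighted_moment m k n)"
          using b_le_S[OF n] by (intro mult_mono) (auto simp: ennroot_def wm_eq W_nonneg)
        finally have "1 / (S n * ennroot (2 * n) (weighted_moment m k n)) \<le> 1 / ennreal (root n (M n))"
          by (auto simp: divide_ennreal_def intro: ennreal_inverse_antimono)
        also have "\<dots> = ennreal (1 / root n (M n))"
          using M_pos[of n] n divide_ennreal[of 1 "root n (M n)"] by simp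
        finally show ?thesis .
      qed
      have "(\<Sum>j. let n = Suc j in 1 / (S n * ennroot (2 * n) (weighted_moment m k n)))
          \<le> (\<Sum>j. ennreal (1 / root (Suc j) (M (Suc j))))"
        unfolding Let_def by (intro suminf_le summableI term_le) simp
      moreover have "(\<Sum>j. let n = Suc j in 1 / (S n * ennroot (2 * n) (weighted_moment m k n))) = \<infinity>"
        using assms(6) by (simp only: S_def)
      moreover have "(\<Sum>j. ennreal (1 / root (Suc j) (M (Suc j)))) \<noteq> top"
        using summable M_pos by (intro ennreal_suminf_neq_top) (auto intro: less_imp_le)
      ultimately show False
        by (simp add: top_unique)
    qed
  qed (simp add: M_def)
  then show ?thesis
    unfolding determining_def M_def using total coeff_finite by blast
qed

end
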